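(* The b-embedding $\iota_b:\mathrm{Cyl}_S^*\to\underline{\mathrm{Cyl}}^*$ intertwines the dual action of holomorphic functions of finitely many holonomies of the complex connection $\mathfrak{Z}$ along straight edges. That is, let $F:\mathcal{A}^{\mathbb{C}}\to\mathbb{C}$ be of the form $F(\mathfrak{Z})=\tilde F(\mathfrak{Z}(e_1),\dots,\mathfrak{Z}(e_n))$ with $e_1,\dots,e_n$ straight edges and $\tilde F:\mathrm{SL}(2,\mathbb{C})^n\to\mathbb{C}$ holomorphic. Then $$F(\hat{\mathfrak{Z}})^*\circ\iota_b=\iota_b\circ F(s(\hat z))^*$$ as maps $\mathrm{Cyl}_S^*\to\underline{\mathrm{Cyl}}^*$, where ${}^*$ denotes the dual action.
   Context: **Connections and symmetric phase space.** $M$ is the spatial 3-manifold with a fixed (analytic) action $(x,\rho)\mapsto\phi_{(x,\rho)}$ of the Euclidean group $\mathscr{E}=\mathbb{R}^3\rtimes\mathrm{SO}(3)$ (spatially flat case: $M\cong\mathbb{R}^3$ with the standard action). $\mathcal{A}$ is the space of smooth $\mathrm{SU}(2)$ connections $A^i_a$ on $M$ (components with respect to $\tau_i=-\frac{i}{2}\sigma_i$), $\mathcal{A}^{\mathbb{C}}$ the space of smooth $\mathrm{SL}(2,\mathbb{C})$ connections, $\Gamma$ the phase space of smooth pairs $(A^i_a,\tilde E^a_i)$ ($\tilde E$ a densitized triad) with $\{A^i_a(x),\tilde E^b_j(y)\}=k\gamma\,\delta^i_j\delta^b_a\delta^3(x,y)$, $k=8\pi G>0$, $\gamma>0$. $\mathscr{E}$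 acts by $(x,\rho)\cdot(A,\tilde E)=(\rho^i{}_j(\phi_{(x,\rho)})_*A^j_a,\ (\rho^{-1})^j{}_i(\phi_{(x,\rho)})_*\tilde E^a_j)$. The invariant connections form a one-dimensional space $\{c\,\mathring{A}:c\in\mathbb{R}\}$ with $\mathring{A}\neq0$ a fixed reference connection; with $\ell_o>0$, $\mathring{e}^a_i$ is the triad with $\mathring{e}^a_i\mathring{A}^j_a=\ell_o^{-1}\delta^j_i$ and $\mathring{q}_{ab}$ its (flat) metric. The invariant phase space is $\Gamma_S=\{(c\mathring{A},\,p\,\mathring{\tilde E}):(c,p)\in\mathbb{R}^2\}$ with $\mathring{\tilde E}^a_i:=\ell_o^{-2}\sqrt{\mathring{q}}\,\mathring{e}^a_i$, and $\{c,p\}=k\gamma/3$. **Cylindrical functions.** $A(e)$ denotes the holonomy along $e$. An edge is straight if it is a geodesic segment of $\mathring{q}$. $\underline{\mathrm{Cyl}}$: functions $\Phi(A)=f(A(e_1),\dots,A(e_n))$ on $\mathcal{A}$, $e_i$ straight, $f:\mathrm{SU}(2)^n\to\mathbb{C}$ real analytic. $r:\mathbb{R}\to\mathcal{A}$, $r(c)=c\mathring{A}$; $\mathrm{Cyl}_S:=r^*[\underline{\mathrm{Cyl}}]$, whose elements are functions of $c\in\mathbb{R}$. $\underline{\mathrm{Cyl}}\subset\mathcal{H}=L^2(\overline{\mathcal{A}},d\mu^o)$ (Ashtekar–Lewandowski measure: the measure whose push-forward to the holonomies of any graph is product Haar measure); $\mathrm{Cyl}_S\subset\mathcal{H}_S=L^2(\overline{\mathbb{R}}_{Bohr},d\mu^o_{Bohr})$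 (Haar measure on the Bohr compactification of $\mathbb{R}$). $\underline{\mathrm{Cyl}}^*$, $\mathrm{Cyl}_S^*$ are algebraic duals; for an operator $O$ on $W$, $O^*$ acts on $W^*$ by $(O^*\psi)(\phi)=\psi(O\phi)$. **Complexifiers.** $C$ is a non-negative, $\mathscr{E}$-invariant function on $\Gamma$ depending only on $\tilde E$, and $C_S$ a non-negative function on $\Gamma_S$ depending only on $p$; $\delta C/\delta\tilde E^a_i(x)$ and $dC_S/dp$ vanish at, and only at, zero momentum. They have non-negative self-adjoint quantizations $\hat C$ on $\mathcal{H}$ and $\hat C_S$ on $\mathcal{H}_S$, with $e^{-\hat C}$ mapping $\underline{\mathrm{Cyl}}$ into itself and $e^{-\hat C_S}$ mapping $\mathrm{Cyl}_S$ into itself. The associated complex coordinates are $$\mathfrak{Z}^i_a=A^i_a-ik\gamma\,\frac{\delta C}{\delta\tilde E^a_i}(\tilde E)\quad\text{on }\Gamma,\qquad z=c-i\frac{k\gamma}{3}\frac{dC_S}{dp}(p)\quad\text{on }\Gamma_S .$$ $s:\mathbb{C}\to\mathcal{A}^{\mathbb{C}}$ is the map with $s(z[\xi])=\mathfrak{Z}[\xi]$ for all $\xi\in\Gamma_S\subset\Gamma$ (it is part of the setting that this defines a map on $\mathbb{C}$), and $C,C_S$ are assumed to be chosen such that $s$ is holomorphic. **Holomorphic representations.** For $\Phi\in\underline{\mathrm{Cyl}}$, $U\Phi$ is the function on $\mathcal{A}^{\mathbb{C}}$ obtained by complex-analytic continuation $A\to\mathfrak{Z}$ of $e^{-\hat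 C}\Phi$: if $(e^{-\hat C}\Phi)(A)=f(A(e_1),\dots,A(e_n))$, then $(U\Phi)(\mathfrak{Z})=f^{\mathbb{C}}(\mathfrak{Z}(e_1),\dots,\mathfrak{Z}(e_n))$ with $f^{\mathbb{C}}$ the holomorphic extension of $f$ to $\mathrm{SL}(2,\mathbb{C})^n$. For $\phi\in\mathrm{Cyl}_S$, $U_S\phi$ is the function on $\mathbb{C}$ obtained by analytic continuation $c\to z$ of $e^{-\hat C_S}\phi$. (Existence of these extensions is part of the setting.) $U$ and $U_S$ are injective. **The b-embedding.** $\pi:=U_S^{-1}\circ s^*\circ U:\underline{\mathrm{Cyl}}\to\mathrm{Cyl}_S$, where $(s^*g)(z)=g(s(z))$; it is part of the setting that $s^*U[\underline{\mathrm{Cyl}}]\subseteq\mathrm{Im}\,U_S$. Then $\iota_b:\mathrm{Cyl}_S^*\to\underline{\mathrm{Cyl}}^*$ is $\iota_b[(\alpha|]\,|\Phi\rangle:=(\alpha|\pi\Phi\rangle$. **Operators.** $F(\hat{\mathfrak{Z}})$ is the operator on $\underline{\mathrm{Cyl}}$ determined by $U(F(\hat{\mathfrak{Z}})\Phi)=F\cdot U\Phi$ (equivalently $F(\hat{\mathfrak{Z}})=e^{\hat C}F(\hat A)e^{-\hat C}$, $F(\hat A)$ being multiplication by the restriction of $F$ to $\mathcal{A}$), and $F(s(\hat z))$ is the operator on $\mathrm{Cyl}_S$ determined by $U_S(F(s(\hat z))\phi)(z)=F(s(z))\,(U_S\phi)(z)$. It is part of the setting that these operators are well defined, i.e. that multiplication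 by $F$ preserves $U[\underline{\mathrm{Cyl}}]$ and multiplication by $F\circ s$ preserves $U_S[\mathrm{Cyl}_S]$. *)

theory Defs
  imports "HOL-Analysis.Analysis" "HOL-Complex_Analysis.Complex_Analysis"
    "HOL-Probability.Probability"
begin

section \<open>Smooth fields on \<open>M = \<real>\<^sup>3\<close>\<close>

fun iter_deriv ::
  "'a list \<Rightarrow> ('a::real_normed_vector \<Rightarrow> 'b::real_normed_vector) \<Rightarrow> 'a \<Rightarrow> 'b" where
  "iter_deriv [] f = f"
| "iter_deriv (v # vs) f = (\<lambda>x. frechet_derivative (iter_deriv vs f) (at x) v)"

definition smooth :: "('a::real_normed_vector \<Rightarrow> 'b::real_normed_vector) \<Rightarrow> bool" where
  "smooth f \<longleftrightarrow> (\<forall>vs x. iter_deriv vs f differentiable (at x))"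

text \<open>
  Index convention: \<open>A x $ i $ a\<close> is the component \<open>A\<^sup>i\<^sub>a(x)\<close> of a connection, with internal index
  \<open>i\<close> first, and \<open>E x $ i $ a\<close> is the component \<open>E\<^sup>a\<^sub>i(x)\<close> of a (densitized) triad. The components of
  connections refer to the basis \<open>tau\<close> below, so an \<open>SU(2)\<close> connection has real components
  and an \<open>SL(2,\<complex>)\<close> connection has complex ones. No nondegeneracy of the densitized triad is
  required, since \<open>p = 0\<close> is a point of the invariant phase space.
\<close>

type_synonym rfield = "real^3 \<Rightarrow> real^3^3"
type_synonym cfield = "real^3 \<Rightarrow> complex^3^3"

definition SU2_conns :: "rfield set" where "SU2_conns = {A. smooth A}"
definition SL2C_conns :: "cfield set" where "SL2C_conns = {Z. smooth Z}"
definition phase_space :: "(rfield \<times> rfield) set" where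
  "phase_space = SU2_conns \<times> {E. smooth E}"

definition cplx_conn :: "rfield \<Rightarrow> cfield" where
  "cplx_conn A x = (\<chi> i a. complex_of_real (A x $ i $ a))"


section \<open>Action of the Euclidean group\<close>

definition rotation :: "real^3^3 \<Rightarrow> bool" where
  "rotation \<rho> \<longleftrightarrow> orthogonal_matrix \<rho> \<and> det \<rho> = 1"

text \<open>
  The diffeomorphism of \<open>(v, \<rho>)\<close> is \<open>y \<mapsto> \<rho> y + v\<close>. The factor to the left of the field acts on the
  internal index, the factor to the right is the push-forward of a one-form, respectively of a
  vector density (whose Jacobian determinant is 1).
\<close>

definition act_conn :: "real^3 \<Rightarrow> real^3^3 \<Rightarrow> rfield \<Rightarrow> rfield" where
  "act_conn v \<rho> A y = \<rho> ** A (matrix_inv \<rho> *v (y - v)) ** matrix_inv \<rho>"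

definition act_triad :: "real^3 \<Rightarrow> real^3^3 \<Rightarrow> rfield \<Rightarrow> rfield" where
  "act_triad v \<rho> E y =
     transpose (matrix_inv \<rho>) ** E (matrix_inv \<rho> *v (y - v)) ** transpose \<rho>"

definition euclid_act :: "real^3 \<Rightarrow> real^3^3 \<Rightarrow> rfield \<times> rfield \<Rightarrow> rfield \<times> rfield" where
  "euclid_act v \<rho> \<xi> = (act_conn v \<rho> (fst \<xi>), act_triad v \<rho> (snd \<xi>))"

definition invariant_conns :: "rfield set" where
  "invariant_conns = {A \<in> SU2_conns. \<forall>v \<rho>. rotation \<rho> \<longrightarrow> act_conn v \<rho> A = A}"


section \<open>Reference triad, reference metric and the invariant phase space\<close>

text \<open>The unique \<open>e\<close> with \<open>e\<^sup>a\<^sub>i A0\<^sup>j\<^sub>a = l\<^sup>-\<^sup>1 \<delta>\<^sup>j\<^sub>i\<close>, that is \<open>e ** transpose A0 = l\<^sup>-\<^sup>1 mat 1\<close>.\<close>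
definition ref_triad :: "real \<Rightarrow> rfield \<Rightarrow> rfield" where
  "ref_triad l A0 x = (1 / l) *\<^sub>R matrix_inv (transpose (A0 x))"

text \<open>The inverse metric of a triad is \<open>q\<^sup>a\<^sup>b = e\<^sup>a\<^sub>i e\<^sup>b\<^sub>i\<close>.\<close>
definition ref_metric :: "real \<Rightarrow> rfield \<Rightarrow> rfield" where
  "ref_metric l A0 x = matrix_inv (transpose (ref_triad l A0 x) ** ref_triad l A0 x)"

definition ref_density :: "real \<Rightarrow> rfield \<Rightarrow> rfield" where
  "ref_density l A0 x =
     (1 / l\<^sup>2) *\<^sub>R sqrt (det (ref_metric l A0 x)) *\<^sub>R ref_triad l A0 x"

text \<open>The point of the invariant phase space with coordinates \<open>(c, p)\<close>.\<close>
definition sym_point :: "real \<Rightarrow> rfield \<Rightarrow> real \<Rightarrow> real \<Rightarrow> rfield \<times> rfield" where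
  "sym_point l A0 c p = ((\<lambda>x. c *\<^sub>R A0 x), (\<lambda>x. p *\<^sub>R ref_density l A0 x))"


section \<open>Edges\<close>

type_synonym curve = "real \<Rightarrow> real^3"

text \<open>Edges are analytically embedded arcs, parametrized by \<open>{0..1}\<close>.\<close>
definition is_edge :: "curve \<Rightarrow> bool" where
  "is_edge e \<longleftrightarrow> inj_on e {0..1} \<and>
     (\<forall>t\<in>{0..1}. vector_derivative e (at t within {0..1}) \<noteq> 0 \<and>
        (\<exists>r>0. \<exists>a. \<forall>u\<in>{0..1}. \<bar>u - t\<bar> < r \<longrightarrow> (\<lambda>m. (u - t) ^ m *\<^sub>R a m) sums e u))"

definition partial :: "3 \<Rightarrow> (real^3 \<Rightarrow> real) \<Rightarrow> real^3 \<Rightarrow> real" where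
  "partial a f x = frechet_derivative f (at x) (axis a 1)"

definition christoffel :: "rfield \<Rightarrow> 3 \<Rightarrow> 3 \<Rightarrow> 3 \<Rightarrow> real^3 \<Rightarrow> real" where
  "christoffel q a b c x =
     (\<Sum>d\<in>UNIV. matrix_inv (q x) $ a $ d *
        (partial b (\<lambda>y. q y $ d $ c) x + partial c (\<lambda>y. q y $ d $ b) x
         - partial d (\<lambda>y. q y $ b $ c) x)) / 2"

definition geodesic :: "rfield \<Rightarrow> curve \<Rightarrow> bool" where
  "geodesic q e \<longleftrightarrow> (\<exists>v. \<forall>t\<in>{0..1}.
     (e has_vector_derivative v t) (at t within {0..1}) \<and>
     (v has_vector_derivative
        (\<chi> a. - (\<Sum>b\<in>UNIV. \<Sum>c\<in>UNIV. christoffel q a b c (e t) * v t $ b * v t $ c)))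
       (at t within {0..1}))"

definition straight_edge :: "rfield \<Rightarrow> curve \<Rightarrow> bool" where
  "straight_edge q e \<longleftrightarrow> is_edge e \<and> geodesic q e"


section \<open>The groups and holonomies\<close>

type_synonym mat2 = "complex^2^2"

definition cscale :: "complex \<Rightarrow> mat2 \<Rightarrow> mat2" where
  "cscale z X = (\<chi> i j. z * X $ i $ j)"

definition pauli :: "3 \<Rightarrow> mat2" where
  "pauli i = (if i = 1 then vector [vector [0, 1], vector [1, 0]]
              else if i = 2 then vector [vector [0, - \<i>], vector [\<i>, 0]]
              else vector [vector [1, 0], vector [0, - 1]])"

definition tau :: "3 \<Rightarrow> mat2" where
  "tau i = cscale (- \<i> / 2) (pauli i)"

definition SU2 :: "mat2 set" where
  "SU2 = {g. g ** (\<chi> i j. cnj (g $ j $ i)) = mat 1 \<and> det g = 1}"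

definition SL2C :: "mat2 set" where
  "SL2C = {g. det g = 1}"

definition conn_along :: "cfield \<Rightarrow> curve \<Rightarrow> real \<Rightarrow> mat2" where
  "conn_along Z e t = (\<Sum>i\<in>UNIV. cscale
     (\<Sum>a\<in>UNIV. Z (e t) $ i $ a *
        complex_of_real (vector_derivative e (at t within {0..1}) $ a)) (tau i))"

text \<open>
  The path-ordered exponential, as the value at 1 of the solution of the parallel transport
  equation. The opposite sign or ordering convention gives the same cylindrical functions.
\<close>
definition hol :: "cfield \<Rightarrow> curve \<Rightarrow> mat2" where
  "hol Z e = (THE H. \<exists>h. h 0 = mat 1 \<and> h 1 = H \<and>
     (\<forall>t\<in>{0..1}. (h has_vector_derivative - (conn_along Z e t ** h t)) (at t within {0..1})))"


section \<open>Analytic functions on products of the groups\<close>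

text \<open>
  Elements of \<open>S\<^sup>n\<close> are lists. The analytic structure is that of the exponential charts
  \<open>x \<mapsto> (g\<^sub>k exp(x\<^sub>k\<^sup>i \<tau>\<^sub>i))\<^sub>k\<close> centred at the points \<open>g\<close> of \<open>S\<^sup>n\<close>, with coordinates in
  \<open>K = \<real>\<close> for \<open>SU(2)\<close> and in \<open>K = \<complex>\<close> for \<open>SL(2,\<complex>)\<close>. In such a chart an analytic function is the sum of a
  power series in the \<open>3n\<close> coordinates.
\<close>

definition tuples :: "'a set \<Rightarrow> nat \<Rightarrow> 'a list set" where
  "tuples S n = {gs. length gs = n \<and> set gs \<subseteq> S}"

definition mat_exp :: "mat2 \<Rightarrow> mat2" where
  "mat_exp X = (\<Sum>m. (1 / fact m) *\<^sub>R ((\<lambda>Y. X ** Y) ^^ m) (mat 1))"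

definition exp_chart :: "mat2 list \<Rightarrow> (nat \<Rightarrow> complex^3) \<Rightarrow> mat2 list" where
  "exp_chart gs x =
     map (\<lambda>k. gs ! k ** mat_exp (\<Sum>i\<in>UNIV. cscale (x k $ i) (tau i))) [0..<length gs]"

definition multi_indices :: "nat \<Rightarrow> (nat \<times> 3 \<Rightarrow> nat) set" where
  "multi_indices n = {\<alpha>. \<forall>k i. n \<le> k \<longrightarrow> \<alpha> (k, i) = 0}"

definition monomial :: "nat \<Rightarrow> (nat \<Rightarrow> complex^3) \<Rightarrow> (nat \<times> 3 \<Rightarrow> nat) \<Rightarrow> complex" where
  "monomial n x \<alpha> = (\<Prod>k<n. \<Prod>i\<in>UNIV. (x k $ i) ^ \<alpha> (k, i))"

definition chart_analytic ::
  "complex set \<Rightarrow> mat2 set \<Rightarrow> nat \<Rightarrow> (mat2 list \<Rightarrow> complex) \<Rightarrow> bool" where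
  "chart_analytic K S n f \<longleftrightarrow> (\<forall>gs\<in>tuples S n. \<exists>r>0. \<exists>b.
     \<forall>x. (\<forall>k<n. \<forall>i. x k $ i \<in> K \<and> cmod (x k $ i) < r) \<longrightarrow>
       ((\<lambda>\<alpha>. b \<alpha> * monomial n x \<alpha>) has_sum f (exp_chart gs x)) (multi_indices n))"

definition real_analytic_SU2 :: "nat \<Rightarrow> (mat2 list \<Rightarrow> complex) \<Rightarrow> bool" where
  "real_analytic_SU2 = chart_analytic \<real> SU2"

definition holomorphic_SL2C :: "nat \<Rightarrow> (mat2 list \<Rightarrow> complex) \<Rightarrow> bool" where
  "holomorphic_SL2C = chart_analytic UNIV SL2C"


section \<open>Cylindrical functions\<close>

text \<open>Functions on \<open>SU2_conns\<close> and \<open>SL2C_conns\<close> are taken to be \<open>undefined\<close> off these sets.\<close>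

definition cyl_fun :: "(mat2 list \<Rightarrow> complex) \<Rightarrow> curve list \<Rightarrow> rfield \<Rightarrow> complex" where
  "cyl_fun f es = (\<lambda>A\<in>SU2_conns. f (map (hol (cplx_conn A)) es))"

definition cyl_fun_cplx :: "(mat2 list \<Rightarrow> complex) \<Rightarrow> curve list \<Rightarrow> cfield \<Rightarrow> complex" where
  "cyl_fun_cplx f es = (\<lambda>Z\<in>SL2C_conns. f (map (hol Z) es))"

definition Cyl :: "rfield \<Rightarrow> (rfield \<Rightarrow> complex) set" where
  "Cyl q = {cyl_fun f es | f es.
     (\<forall>e\<in>set es. straight_edge q e) \<and> real_analytic_SU2 (length es) f}"

definition Cyl_S :: "rfield \<Rightarrow> rfield \<Rightarrow> (real \<Rightarrow> complex) set" where
  "Cyl_S q A0 = (\<lambda>\<Phi> c. \<Phi> (\<lambda>x. c *\<^sub>R A0 x)) ` Cyl q"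


section \<open>Operators on square-integrable functions\<close>

text \<open>
  Elements of \<open>L\<^sup>2\<close> are handled through their representatives. An operator is a set of pairs
  (argument, value) of representatives. Self-adjointness in the sense below forces this
  relation to be closed under almost everywhere equality.
\<close>

definition L2 :: "'x measure \<Rightarrow> ('x \<Rightarrow> complex) set" where
  "L2 M = {\<psi> \<in> borel_measurable M. integrable M (\<lambda>x. (cmod (\<psi> x))\<^sup>2)}"

definition L2_inner :: "'x measure \<Rightarrow> ('x \<Rightarrow> complex) \<Rightarrow> ('x \<Rightarrow> complex) \<Rightarrow> complex" where
  "L2_inner M \<phi> \<psi> = (LINT x|M. cnj (\<phi> x) * \<psi> x)"

type_synonym 'x operator = "(('x \<Rightarrow> complex) \<times> ('x \<Rightarrow> complex)) set"

definition adjoint_op :: "'x measure \<Rightarrow> 'x operator \<Rightarrow> 'x operator" where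
  "adjoint_op M T = {(\<phi>, \<eta>) \<in> L2 M \<times> L2 M. \<forall>(\<psi>, \<omega>)\<in>T. L2_inner M \<phi> \<omega> = L2_inner M \<eta> \<psi>}"

definition densely_defined :: "'x measure \<Rightarrow> 'x operator \<Rightarrow> bool" where
  "densely_defined M T \<longleftrightarrow>
     (\<forall>\<phi>\<in>L2 M. \<forall>\<epsilon>>0. \<exists>(\<psi>, \<omega>)\<in>T. Re (L2_inner M (\<lambda>x. \<phi> x - \<psi> x) (\<lambda>x. \<phi> x - \<psi> x)) < \<epsilon>)"

definition self_adjoint_op :: "'x measure \<Rightarrow> 'x operator \<Rightarrow> bool" where
  "self_adjoint_op M T \<longleftrightarrow> densely_defined M T \<and> adjoint_op M T = T"

definition nonneg_op :: "'x measure \<Rightarrow> 'x operator \<Rightarrow> bool" where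
  "nonneg_op M T \<longleftrightarrow> (\<forall>(\<psi>, \<omega>)\<in>T. 0 \<le> Re (L2_inner M \<psi> \<omega>))"

definition projection_measure ::
  "'x measure \<Rightarrow> (real set \<Rightarrow> ('x \<Rightarrow> complex) \<Rightarrow> ('x \<Rightarrow> complex)) \<Rightarrow> bool" where
  "projection_measure M P \<longleftrightarrow>
     (\<forall>B\<in>sets borel. \<forall>\<psi>\<in>L2 M. P B \<psi> \<in> L2 M) \<and>
     (\<forall>B\<in>sets borel. \<forall>\<phi>\<in>L2 M. \<forall>\<psi>\<in>L2 M. L2_inner M \<phi> (P B \<psi>) = L2_inner M (P B \<phi>) \<psi>) \<and>
     (\<forall>B\<in>sets borel. \<forall>B'\<in>sets borel. \<forall>\<psi>\<in>L2 M. AE x in M. P B (P B' \<psi>) x = P (B \<inter> B') \<psi> x) \<and>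
     (\<forall>\<psi>\<in>L2 M. AE x in M. P UNIV \<psi> x = \<psi> x) \<and>
     (\<forall>\<psi>\<in>L2 M. \<forall>B. range B \<subseteq> sets borel \<and> disjoint_family B \<longrightarrow>
        (\<lambda>m::nat. L2_inner M \<psi> (P (B m) \<psi>)) sums L2_inner M \<psi> (P (\<Union>m. B m) \<psi>))"

text \<open>The scalar measure \<open>B \<mapsto> \<langle>\<psi>, P(B) \<psi>\<rangle>\<close>.\<close>
definition scalar_measure ::
  "'x measure \<Rightarrow> (real set \<Rightarrow> ('x \<Rightarrow> complex) \<Rightarrow> ('x \<Rightarrow> complex)) \<Rightarrow> ('x \<Rightarrow> complex)
     \<Rightarrow> real measure" where
  "scalar_measure M P \<psi> =
     measure_of UNIV (sets borel) (\<lambda>B. ennreal (Re (L2_inner M \<psi> (P B \<psi>))))"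

text \<open>
  \<open>T = \<integral> \<lambda> dP(\<lambda>)\<close>. For self-adjoint \<open>T\<close> it suffices that \<open>T\<close> is contained in the spectral
  integral (by polarization on the domain of \<open>T\<close>), since self-adjoint operators are maximal.
\<close>
definition spectral_resolution ::
  "'x measure \<Rightarrow> 'x operator \<Rightarrow> (real set \<Rightarrow> ('x \<Rightarrow> complex) \<Rightarrow> ('x \<Rightarrow> complex)) \<Rightarrow> bool" where
  "spectral_resolution M T P \<longleftrightarrow> projection_measure M P \<and>
     (\<forall>(\<psi>, \<omega>)\<in>T. integrable (scalar_measure M P \<psi>) (\<lambda>t. t\<^sup>2) \<and>
        L2_inner M \<psi> \<omega> = complex_of_real (LINT t|scalar_measure M P \<psi>. t))"

text \<open>\<open>\<integral> g(\<lambda>) d\<langle>\<phi>, P(\<lambda>) \<psi>\<rangle>\<close>, by polarization; the inner product is conjugate linear on the left.\<close>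
definition spectral_form ::
  "'x measure \<Rightarrow> (real set \<Rightarrow> ('x \<Rightarrow> complex) \<Rightarrow> ('x \<Rightarrow> complex)) \<Rightarrow> (real \<Rightarrow> real)
     \<Rightarrow> ('x \<Rightarrow> complex) \<Rightarrow> ('x \<Rightarrow> complex) \<Rightarrow> complex" where
  "spectral_form M P g \<phi> \<psi> =
     (let Q = (\<lambda>\<omega>. complex_of_real (LINT t|scalar_measure M P \<omega>. g t))
      in (Q (\<lambda>x. \<phi> x + \<psi> x) - Q (\<lambda>x. \<phi> x - \<psi> x)
          - \<i> * Q (\<lambda>x. \<phi> x + \<i> * \<psi> x) + \<i> * Q (\<lambda>x. \<phi> x - \<i> * \<psi> x)) / 4)"

text \<open>\<open>e\<^sup>-\<^sup>T = \<integral> e\<^sup>-\<^sup>\<lambda> dP(\<lambda>)\<close> for a nonnegative self-adjoint \<open>T = \<integral> \<lambda> dP(\<lambda>)\<close>.\<close>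
definition exp_neg_op :: "'x measure \<Rightarrow> 'x operator \<Rightarrow> 'x operator" where
  "exp_neg_op M T = {(\<psi>, \<eta>) \<in> L2 M \<times> L2 M. \<exists>P. spectral_resolution M T P \<and>
     (\<forall>\<phi>\<in>L2 M. L2_inner M \<phi> \<eta> = spectral_form M P (\<lambda>t. exp (- t)) \<phi> \<psi>)}"

text \<open>
  A space \<open>W\<close> of functions is identified with a space of \<open>L\<^sup>2\<close> functions on a larger domain
  by a relation \<open>lift\<close>. \<open>induced_op\<close> is the operator which \<open>R\<close> then induces on \<open>W\<close>.
\<close>
definition induced_rel ::
  "('w \<Rightarrow> 'v \<Rightarrow> bool) \<Rightarrow> ('v \<times> 'v) set \<Rightarrow> 'w \<Rightarrow> 'w \<Rightarrow> bool" where
  "induced_rel lift R \<phi> \<psi> \<longleftrightarrow> (\<exists>\<phi>' \<psi>'. lift \<phi> \<phi>' \<and> lift \<psi> \<psi>' \<and> (\<phi>', \<psi>') \<in> R)"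

definition maps_into_itself :: "'w set \<Rightarrow> ('w \<Rightarrow> 'v \<Rightarrow> bool) \<Rightarrow> ('v \<times> 'v) set \<Rightarrow> bool" where
  "maps_into_itself W lift R \<longleftrightarrow> (\<forall>\<phi>\<in>W. \<exists>\<psi>\<in>W. induced_rel lift R \<phi> \<psi>)"

definition induced_op :: "'w set \<Rightarrow> ('w \<Rightarrow> 'v \<Rightarrow> bool) \<Rightarrow> ('v \<times> 'v) set \<Rightarrow> 'w \<Rightarrow> 'w" where
  "induced_op W lift R \<phi> = (THE \<psi>. \<psi> \<in> W \<and> induced_rel lift R \<phi> \<psi>)"


section \<open>Generalized connections and the Ashtekar--Lewandowski measure\<close>

type_synonym gconn = "curve \<Rightarrow> mat2"

definition edges :: "curve set" where "edges = {e. is_edge e}"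

text \<open>
  Two edges with the same image and the same starting point are reparametrizations of each other.
\<close>
definition gen_conns :: "gconn set" where
  "gen_conns = {B \<in> edges \<rightarrow>\<^sub>E SU2.
     (\<forall>e\<in>edges. \<forall>e'\<in>edges.
        pathstart e = pathstart e' \<and> path_image e = path_image e' \<longrightarrow> B e = B e') \<and>
     (\<forall>e\<in>edges. B (reversepath e) = matrix_inv (B e)) \<and>
     (\<forall>e\<in>edges. \<forall>t. 0 < t \<and> t < 1 \<longrightarrow> B e = B (subpath t 1 e) ** B (subpath 0 t e))}"

definition is_graph :: "curve set \<Rightarrow> bool" where
  "is_graph \<gamma> \<longleftrightarrow> finite \<gamma> \<and> \<gamma> \<subseteq> edges \<and>
     (\<forall>e\<in>\<gamma>. \<forall>e'\<in>\<gamma>. e \<noteq> e' \<longrightarrow>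
        path_image e \<inter> path_image e' \<subseteq>
          {pathstart e, pathfinish e} \<inter> {pathstart e', pathfinish e'})"

definition SU2_haar :: "mat2 measure \<Rightarrow> bool" where
  "SU2_haar \<nu> \<longleftrightarrow> prob_space \<nu> \<and> sets \<nu> = sets (restrict_space borel SU2) \<and>
     (\<forall>g\<in>SU2. distr \<nu> \<nu> (\<lambda>h. g ** h) = \<nu>)"

text \<open>
  Here and for the Bohr compactification, measures live on the \<open>\<sigma>\<close>-algebra generated by the
  evaluations, on which they are uniquely determined; passing to the regular Borel measure extending
  it does not change \<open>L\<^sup>2\<close>.
\<close>
definition AL_measure :: "gconn measure \<Rightarrow> bool" where
  "AL_measure \<mu> \<longleftrightarrow>
     sets \<mu> = sets (restrict_space (Pi\<^sub>M edges (\<lambda>_. restrict_space borel SU2)) gen_conns) \<and>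
     (\<exists>\<nu>. SU2_haar \<nu> \<and>
       (\<forall>\<gamma>. is_graph \<gamma> \<longrightarrow>
          distr \<mu> (Pi\<^sub>M \<gamma> (\<lambda>_. \<nu>)) (\<lambda>B. restrict B \<gamma>) = Pi\<^sub>M \<gamma> (\<lambda>_. \<nu>)))"

definition cyl_lift :: "rfield \<Rightarrow> (rfield \<Rightarrow> complex) \<Rightarrow> (gconn \<Rightarrow> complex) \<Rightarrow> bool" where
  "cyl_lift q \<Phi> \<Phi>' \<longleftrightarrow> (\<exists>f es.
     (\<forall>e\<in>set es. straight_edge q e) \<and> real_analytic_SU2 (length es) f \<and>
     \<Phi> = cyl_fun f es \<and> \<Phi>' = (\<lambda>B. f (map B es)))"


section \<open>The Bohr compactification\<close>

text \<open>
  The Bohr compactification of \<open>\<real>\<close> is the dual of the discrete group \<open>\<real>\<close>, with the topology of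
  pointwise convergence; \<open>c\<close> corresponds to the character \<open>m \<mapsto> e\<^sup>i\<^sup>m\<^sup>c\<close>.
\<close>
definition bohr :: "(real \<Rightarrow> complex) set" where
  "bohr = {\<omega>. (\<forall>a. cmod (\<omega> a) = 1) \<and> (\<forall>a b. \<omega> (a + b) = \<omega> a * \<omega> b)}"

definition bohr_haar :: "(real \<Rightarrow> complex) measure \<Rightarrow> bool" where
  "bohr_haar \<mu> \<longleftrightarrow> prob_space \<mu> \<and>
     sets \<mu> = sets (restrict_space (Pi\<^sub>M UNIV (\<lambda>_. borel)) bohr) \<and>
     (\<forall>\<omega>\<in>bohr. distr \<mu> \<mu> (\<lambda>\<xi> a. \<omega> a * \<xi> a) = \<mu>)"

text \<open>Almost periodic functions on \<open>\<real>\<close> extend uniquely by continuity.\<close>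
definition bohr_lift :: "(real \<Rightarrow> complex) \<Rightarrow> ((real \<Rightarrow> complex) \<Rightarrow> complex) \<Rightarrow> bool" where
  "bohr_lift \<phi> \<phi>' \<longleftrightarrow> continuous_on bohr \<phi>' \<and> (\<forall>c. \<phi>' (\<lambda>m. cis (m * c)) = \<phi> c)"


section \<open>Complexifiers\<close>

text \<open>
  \<open>D x $ i $ a\<close> is \<open>\<delta>C/\<delta>E\<^sup>a\<^sub>i(x)\<close> at \<open>(A, E)\<close>, tested against smooth compactly supported variations.
\<close>
definition has_triad_derivative ::
  "(rfield \<times> rfield \<Rightarrow> real) \<Rightarrow> rfield \<times> rfield \<Rightarrow> rfield \<Rightarrow> bool" where
  "has_triad_derivative C \<xi> D \<longleftrightarrow> smooth D \<and>
     (\<forall>h. smooth h \<and> bounded {x. h x \<noteq> 0} \<longrightarrow>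
        ((\<lambda>\<epsilon>. C (fst \<xi>, \<lambda>x. snd \<xi> x + \<epsilon> *\<^sub>R h x)) has_real_derivative
           (LINT x|lborel. (\<Sum>i\<in>UNIV. \<Sum>a\<in>UNIV. D x $ i $ a * h x $ i $ a))) (at 0))"

definition triad_derivative ::
  "(rfield \<times> rfield \<Rightarrow> real) \<Rightarrow> rfield \<times> rfield \<Rightarrow> rfield" where
  "triad_derivative C \<xi> = (THE D. has_triad_derivative C \<xi> D)"

definition full_complexifier :: "(rfield \<times> rfield \<Rightarrow> real) \<Rightarrow> bool" where
  "full_complexifier C \<longleftrightarrow>
     (\<forall>\<xi>\<in>phase_space. 0 \<le> C \<xi>) \<and>
     (\<forall>\<xi>\<in>phase_space. \<forall>v \<rho>. rotation \<rho> \<longrightarrow> C (euclid_act v \<rho> \<xi>) = C \<xi>) \<and>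
     (\<forall>\<xi>\<in>phase_space. \<forall>\<xi>'\<in>phase_space. snd \<xi> = snd \<xi>' \<longrightarrow> C \<xi> = C \<xi>') \<and>
     (\<forall>\<xi>\<in>phase_space. \<exists>D. has_triad_derivative C \<xi> D) \<and>
     (\<forall>\<xi>\<in>phase_space. (\<forall>x. triad_derivative C \<xi> x = 0) \<longleftrightarrow> (\<forall>x. snd \<xi> x = 0))"

text \<open>Functions on the invariant phase space are functions of its coordinates \<open>(c, p)\<close>.\<close>
definition sym_complexifier :: "(real \<times> real \<Rightarrow> real) \<Rightarrow> bool" where
  "sym_complexifier C \<longleftrightarrow>
     (\<forall>c p. 0 \<le> C (c, p)) \<and>
     (\<forall>c c' p. C (c, p) = C (c', p)) \<and>
     (\<forall>c p. (\<lambda>p. C (c, p)) differentiable (at p)) \<and>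
     (\<forall>c p. deriv (\<lambda>p. C (c, p)) p = 0 \<longleftrightarrow> p = 0)"

definition full_coord ::
  "real \<Rightarrow> real \<Rightarrow> (rfield \<times> rfield \<Rightarrow> real) \<Rightarrow> rfield \<times> rfield \<Rightarrow> cfield" where
  "full_coord k \<gamma> C \<xi> x = (\<chi> i a. complex_of_real (fst \<xi> x $ i $ a)
     - \<i> * complex_of_real (k * \<gamma> * triad_derivative C \<xi> x $ i $ a))"

definition sym_coord ::
  "real \<Rightarrow> real \<Rightarrow> (real \<times> real \<Rightarrow> real) \<Rightarrow> real \<Rightarrow> real \<Rightarrow> complex" where
  "sym_coord k \<gamma> C c p = complex_of_real c
     - \<i> * complex_of_real (k * \<gamma> / 3 * deriv (\<lambda>p. C (c, p)) p)"

text \<open>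
  \<open>s\<close> is determined on all of \<open>\<complex>\<close> by its values on the invariant phase space, whence the
  surjectivity of the coordinate there. Holomorphy of \<open>s\<close> is that of its components.
\<close>
definition induced_conn_map ::
  "(real \<Rightarrow> real \<Rightarrow> complex) \<Rightarrow> (real \<Rightarrow> real \<Rightarrow> cfield) \<Rightarrow> (complex \<Rightarrow> cfield) \<Rightarrow> bool" where
  "induced_conn_map z Z s \<longleftrightarrow> (\<forall>w. s w \<in> SL2C_conns) \<and>
     (\<forall>c p. s (z c p) = Z c p) \<and> (\<forall>w. \<exists>c p. w = z c p)"

definition holomorphic_conn_map :: "(complex \<Rightarrow> cfield) \<Rightarrow> bool" where
  "holomorphic_conn_map s \<longleftrightarrow> (\<forall>x i a. (\<lambda>w. s w x $ i $ a) holomorphic_on UNIV)"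


section \<open>Holomorphic representations\<close>

definition cyl_continuation ::
  "rfield \<Rightarrow> (rfield \<Rightarrow> complex) \<Rightarrow> (cfield \<Rightarrow> complex) \<Rightarrow> bool" where
  "cyl_continuation q \<Psi> G \<longleftrightarrow> (\<exists>f fC es.
     (\<forall>e\<in>set es. straight_edge q e) \<and> real_analytic_SU2 (length es) f \<and>
     \<Psi> = cyl_fun f es \<and>
     holomorphic_SL2C (length es) fC \<and> (\<forall>gs\<in>tuples SU2 (length es). fC gs = f gs) \<and>
     G = cyl_fun_cplx fC es)"

definition real_continuation :: "(real \<Rightarrow> complex) \<Rightarrow> (complex \<Rightarrow> complex) \<Rightarrow> bool" where
  "real_continuation \<psi> g \<longleftrightarrow> g holomorphic_on UNIV \<and> (\<forall>c. g (complex_of_real c) = \<psi> c)"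

definition hol_rep ::
  "rfield \<Rightarrow> gconn measure \<Rightarrow> gconn operator \<Rightarrow> (rfield \<Rightarrow> complex) \<Rightarrow> (cfield \<Rightarrow> complex)" where
  "hol_rep q \<mu> Chat \<Phi> =
     (THE G. cyl_continuation q (induced_op (Cyl q) (cyl_lift q) (exp_neg_op \<mu> Chat) \<Phi>) G)"

definition hol_rep_S ::
  "rfield \<Rightarrow> rfield \<Rightarrow> (real \<Rightarrow> complex) measure \<Rightarrow> (real \<Rightarrow> complex) operator
     \<Rightarrow> (real \<Rightarrow> complex) \<Rightarrow> (complex \<Rightarrow> complex)" where
  "hol_rep_S q A0 \<mu> Chat \<phi> =
     (THE g. real_continuation (induced_op (Cyl_S q A0) bohr_lift (exp_neg_op \<mu> Chat) \<phi>) g)"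


section \<open>The b-embedding and dual actions\<close>

text \<open>Algebraic dual of a complex vector space of functions; functionals are \<open>undefined\<close> off it.\<close>
definition alg_dual :: "('x \<Rightarrow> complex) set \<Rightarrow> (('x \<Rightarrow> complex) \<Rightarrow> complex) set" where
  "alg_dual W = {\<alpha> \<in> extensional W. \<forall>\<phi>\<in>W. \<forall>\<psi>\<in>W. \<forall>a b.
     \<alpha> (\<lambda>x. a * \<phi> x + b * \<psi> x) = a * \<alpha> \<phi> + b * \<alpha> \<psi>}"

definition dual_action ::
  "'w set \<Rightarrow> ('w \<Rightarrow> 'w) \<Rightarrow> ('w \<Rightarrow> complex) \<Rightarrow> ('w \<Rightarrow> complex)" where
  "dual_action W T \<psi> = (\<lambda>\<phi>\<in>W. \<psi> (T \<phi>))"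

definition b_proj ::
  "'v set \<Rightarrow> ('w \<Rightarrow> cfield \<Rightarrow> complex) \<Rightarrow> ('v \<Rightarrow> complex \<Rightarrow> complex) \<Rightarrow> (complex \<Rightarrow> cfield)
     \<Rightarrow> 'w \<Rightarrow> 'v" where
  "b_proj V U U\<^sub>S s \<Phi> = inv_into V U\<^sub>S (\<lambda>z. U \<Phi> (s z))"

definition b_embed :: "'w set \<Rightarrow> ('w \<Rightarrow> 'v) \<Rightarrow> ('v \<Rightarrow> complex) \<Rightarrow> ('w \<Rightarrow> complex)" where
  "b_embed W pr \<alpha> = (\<lambda>\<Phi>\<in>W. \<alpha> (pr \<Phi>))"

text \<open>
  Multiplication operators in the holomorphic representations, on functions on \<open>D\<close>: the operator
  \<open>T\<close> on \<open>W\<close> with \<open>U (T \<Phi>) = F \<cdot> U \<Phi>\<close>.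
\<close>
definition rep_mult ::
  "'x set \<Rightarrow> 'w set \<Rightarrow> ('w \<Rightarrow> 'x \<Rightarrow> complex) \<Rightarrow> ('x \<Rightarrow> complex) \<Rightarrow> 'w \<Rightarrow> 'w" where
  "rep_mult D W U F \<Phi> = inv_into W U (\<lambda>x\<in>D. F x * U \<Phi> x)"

definition mult_preserves :: "'x set \<Rightarrow> ('x \<Rightarrow> complex) \<Rightarrow> ('x \<Rightarrow> complex) set \<Rightarrow> bool" where
  "mult_preserves D F R \<longleftrightarrow> (\<forall>g\<in>R. (\<lambda>x\<in>D. F x * g x) \<in> R)"

end

theory Submission
  imports Defs
begin

text \<open>The projection \<open>\<pi>\<^sub>b\<close> is pull-back along \<open>s\<close>, read
  through the representations \<open>U\<close> and \<open>U\<^sub>S\<close>, and pull-back is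
  multiplicative: (F * g) o s = (F o s) * (g o s). With g = \<open>U \<Phi>\<close>, the left side
  represents \<open>\<pi>\<^sub>b (FZ \<Phi>)\<close> and the right side is F o s times the
  representative of \<open>\<pi>\<^sub>b \<Phi>\<close>. Hence \<open>\<pi>\<^sub>b\<close>
  intertwines \<open>FZ\<close> with \<open>Fs\<close> (\<open>b_proj_rep_mult\<close>). The
  b-embedding is composition with \<open>\<pi>\<^sub>b\<close>, so the claim is the transpose of
  this relation (\<open>dual_action_b_embed\<close>).\<close>

lemma rep_mult_rep:
  assumes "mult_preserves D F (U ` W)" and "\<Phi> \<in> W"
  shows "rep_mult D W U F \<Phi> \<in> W" and "U (rep_mult D W U F \<Phi>) = (\<lambda>x\<in>D. F x * U \<Phi> x)"
proof -
  \<comment> \<open>The product stays in the range of \<open>U\<close>, where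
    \<open>inv_into W U\<close> is a right inverse of \<open>U\<close>.\<close>
  have "(\<lambda>x\<in>D. F x * U \<Phi> x) \<in> U ` W"
    using assms by (auto simp: mult_preserves_def)
  then show "rep_mult D W U F \<Phi> \<in> W" and "U (rep_mult D W U F \<Phi>) = (\<lambda>x\<in>D. F x * U \<Phi> x)"
    unfolding rep_mult_def by (rule inv_into_into, rule f_inv_into_f)
qed

text \<open>Both sides are \<open>inv_into W\<^sub>S U\<^sub>S\<close> of one and the same function,
  z mapped to \<open>F (s z) * U \<Phi> (s z)\<close>.\<close>

lemma b_proj_rep_mult:
  assumes s: "\<And>z. s z \<in> D"
    and preserves: "mult_preserves D F (U ` W)"
    and pull_back: "(\<lambda>z. U \<Phi> (s z)) \<in> U\<^sub>S ` W\<^sub>S"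
    and \<Phi>: "\<Phi> \<in> W"
  shows "b_proj W\<^sub>S U U\<^sub>S s (rep_mult D W U F \<Phi>) =
    rep_mult UNIV W\<^sub>S U\<^sub>S (\<lambda>z. F (s z)) (b_proj W\<^sub>S U U\<^sub>S s \<Phi>)"
proof -
  have "U\<^sub>S (b_proj W\<^sub>S U U\<^sub>S s \<Phi>) = (\<lambda>z. U \<Phi> (s z))"
    unfolding b_proj_def using pull_back by (rule f_inv_into_f)
  \<comment> \<open>Only the left-hand \<open>b_proj\<close> is unfolded; the right-hand one stays
    intact, to be rewritten by the equation just proved. Since \<open>s z\<close> lies in
    \<open>D\<close>, the product is never evaluated at a point where \<open>restrict\<close>
    returns \<open>undefined\<close>.\<close>
  then show ?thesis
    using s by (simp add: b_proj_def [of _ _ _ _ "rep_mult D W U F \<Phi>"]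
        rep_mult_rep(2) [OF preserves \<Phi>] rep_mult_def [of UNIV] restrict_def)
qed

text \<open>At a point of \<open>W\<close> the two sides are \<open>\<alpha> (pr (T \<Phi>))\<close>
  and \<open>\<alpha> (S (pr \<Phi>))\<close>. The two membership premises keep the arguments inside
  the sets to which \<open>b_embed\<close> and \<open>dual_action\<close> restrict; off
  \<open>W\<close> both sides are \<open>undefined\<close>.\<close>

lemma dual_action_b_embed:
  assumes "\<And>\<Phi>. \<Phi> \<in> W \<Longrightarrow> T \<Phi> \<in> W" and "\<And>\<Phi>. \<Phi> \<in> W \<Longrightarrow> pr \<Phi> \<in> V"
    and "\<And>\<Phi>. \<Phi> \<in> W \<Longrightarrow> pr (T \<Phi>) = S (pr \<Phi>)"
  shows "dual_action W T (b_embed W pr \<alpha>) = b_embed W pr (dual_action V S \<alpha>)"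
  using assms by (auto simp: dual_action_def b_embed_def)

theorem proposition3:
  fixes G \<gamma> l\<^sub>o k :: real
    and A0 q :: rfield
    and C :: "rfield \<times> rfield \<Rightarrow> real" and C\<^sub>S :: "real \<times> real \<Rightarrow> real"
    and \<mu> :: "gconn measure" and Chat :: "gconn operator"
    and \<mu>\<^sub>B :: "(real \<Rightarrow> complex) measure" and Chat\<^sub>S :: "(real \<Rightarrow> complex) operator"
    and s :: "complex \<Rightarrow> cfield"
    and es :: "curve list" and Ft :: "mat2 list \<Rightarrow> complex" and F :: "cfield \<Rightarrow> complex"
    and W :: "(rfield \<Rightarrow> complex) set" and W\<^sub>S :: "(real \<Rightarrow> complex) set"
    and U :: "(rfield \<Rightarrow> complex) \<Rightarrow> cfield \<Rightarrow> complex"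
    and U\<^sub>S :: "(real \<Rightarrow> complex) \<Rightarrow> complex \<Rightarrow> complex"
    and \<pi>\<^sub>b :: "(rfield \<Rightarrow> complex) \<Rightarrow> real \<Rightarrow> complex"
    and \<iota>\<^sub>b :: "((real \<Rightarrow> complex) \<Rightarrow> complex) \<Rightarrow> (rfield \<Rightarrow> complex) \<Rightarrow> complex"
    and FZ :: "(rfield \<Rightarrow> complex) \<Rightarrow> rfield \<Rightarrow> complex"
    and Fs :: "(real \<Rightarrow> complex) \<Rightarrow> real \<Rightarrow> complex"
  assumes constants: "G > 0" "k = 8 * pi * G" "\<gamma> > 0" "l\<^sub>o > 0"
    and A0: "A0 \<noteq> (\<lambda>x. 0)" "invariant_conns = {\<lambda>x. c *\<^sub>R A0 x | c. True}"
    and q: "q = ref_metric l\<^sub>o A0"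
    and measures: "AL_measure \<mu>" "bohr_haar \<mu>\<^sub>B"
    and complexifiers: "full_complexifier C" "sym_complexifier C\<^sub>S"
    and quantizations: "self_adjoint_op \<mu> Chat" "nonneg_op \<mu> Chat"
      "self_adjoint_op \<mu>\<^sub>B Chat\<^sub>S" "nonneg_op \<mu>\<^sub>B Chat\<^sub>S"
    and W: "W = Cyl q" and W\<^sub>S: "W\<^sub>S = Cyl_S q A0"
    and heat: "maps_into_itself W (cyl_lift q) (exp_neg_op \<mu> Chat)"
      "maps_into_itself W\<^sub>S bohr_lift (exp_neg_op \<mu>\<^sub>B Chat\<^sub>S)"
    and s: "induced_conn_map (sym_coord k \<gamma> C\<^sub>S)
              (\<lambda>c p. full_coord k \<gamma> C (sym_point l\<^sub>o A0 c p)) s"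
      "holomorphic_conn_map s"
    and continuations:
      "\<forall>\<Phi>\<in>W. \<exists>g. cyl_continuation q (induced_op W (cyl_lift q) (exp_neg_op \<mu> Chat) \<Phi>) g"
      "\<forall>\<phi>\<in>W\<^sub>S. \<exists>g. real_continuation (induced_op W\<^sub>S bohr_lift (exp_neg_op \<mu>\<^sub>B Chat\<^sub>S) \<phi>) g"
    and U: "U = hol_rep q \<mu> Chat" "inj_on U W"
    and U\<^sub>S: "U\<^sub>S = hol_rep_S q A0 \<mu>\<^sub>B Chat\<^sub>S" "inj_on U\<^sub>S W\<^sub>S"
    and pull_back: "\<forall>\<Phi>\<in>W. (\<lambda>z. U \<Phi> (s z)) \<in> U\<^sub>S ` W\<^sub>S"
    and \<pi>\<^sub>b: "\<pi>\<^sub>b = b_proj W\<^sub>S U U\<^sub>S s"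
    and \<iota>\<^sub>b: "\<iota>\<^sub>b = b_embed W \<pi>\<^sub>b"
    and F: "\<forall>e\<in>set es. straight_edge q e" "holomorphic_SL2C (length es) Ft"
      "F = cyl_fun_cplx Ft es"
    and preserves: "mult_preserves SL2C_conns F (U ` W)"
      "mult_preserves UNIV (\<lambda>z. F (s z)) (U\<^sub>S ` W\<^sub>S)"
    and FZ: "FZ = rep_mult SL2C_conns W U F"
    and Fs: "Fs = rep_mult UNIV W\<^sub>S U\<^sub>S (\<lambda>z. F (s z))"
  shows "\<forall>\<alpha>\<in>alg_dual W\<^sub>S.
    (dual_action W FZ \<circ> \<iota>\<^sub>b) \<alpha> = (\<iota>\<^sub>b \<circ> dual_action W\<^sub>S Fs) \<alpha>"
proof -
  have sD: "s z \<in> SL2C_conns" for z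
    using s(1) by (simp add: induced_conn_map_def)
  have "dual_action W FZ (\<iota>\<^sub>b \<alpha>) = \<iota>\<^sub>b (dual_action W\<^sub>S Fs \<alpha>)" for \<alpha>
    unfolding \<iota>\<^sub>b
  proof (rule dual_action_b_embed)
    fix \<Phi> assume \<Phi>: "\<Phi> \<in> W"
    show "FZ \<Phi> \<in> W"
      unfolding FZ using preserves(1) \<Phi> by (rule rep_mult_rep)
    show "\<pi>\<^sub>b \<Phi> \<in> W\<^sub>S"
      unfolding \<pi>\<^sub>b b_proj_def using pull_back \<Phi> by (blast intro: inv_into_into)
    \<comment> \<open>The intertwining relation before dualization, with \<open>SL2C_conns\<close>
      as the domain on which \<open>F\<close> multiplies.\<close>
    show "\<pi>\<^sub>b (FZ \<Phi>) = Fs (\<pi>\<^sub>b \<Phi>)"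
      unfolding \<pi>\<^sub>b FZ Fs
      using sD preserves(1) bspec [OF pull_back \<Phi>] \<Phi> by (rule b_proj_rep_mult)
  qed
  then show ?thesis by simp
qed

end
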